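(* Let $N\ge1$ and let $\bm A\in\mathbb R^{N\times N}$, $\bm B\in\mathbb R^N$ be given, for $0\le n,k\le N-1$, by $$\bm A_{nk}=-(2n+1)^{1/2}(2k+1)^{1/2}\cdot\begin{cases}1&n>k\\ \frac{n+1}{2n+1}&n=k\\0&n<k\end{cases},\qquad \bm B_n=(2n+1)^{1/2}.$$ Then the SSM $(\bm A,\bm B)$ is a TOSSM with measure and basis $$\omega(t)=e^{-t},\qquad p_n(t)=L_n(e^{-t})\qquad(t\ge0).$$
   Context: $L_n$ denotes the Legendre polynomial of degree $n$ rescaled to be orthonormal on $[0,1]$: $\int_0^1L_nL_m=\delta_{nm}$, with $L_n(1)=(2n+1)^{1/2}$. A time-invariant SSM $(\bm A,\bm B)$ is the system $x'(t)=\bm Ax(t)+\bm Bu(t)$; its basis kernels are $K_n(t)=\bm e_n^\top e^{t\bm A}\bm B$, $t\ge0$, so that $x_n(t)=\int_{-\infty}^tK_n(t-s)u(s)\,ds$. It is a time-invariant orthogonal SSM (TOSSM) with basis $p_n(t)$ and measure $\omega(t)\ge0$ if $K_n(t)=p_n(t)\omega(t)$ for all $t\ge0$ and all $n$, and $\int_0^\infty p_n(t)p_m(t)\omega(t)\,dt=\delta_{nm}$. *)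

theory Defs
  imports
    "HOL-Analysis.Analysis"
    "HOL-Computational_Algebra.Polynomial"
    "Jordan_Normal_Form.Matrix"
begin

unbundle no vec_syntax
no_notation inner (infix \<open>\<bullet>\<close> 70)
hide_type (open) Finite_Cartesian_Product.vec
hide_const (open) Module.smult

subsection \<open>Orthonormal Legendre polynomials on the unit interval\<close>

text \<open>The classical Legendre polynomial on \<open>[-1,1]\<close>, by Rodrigues' formula.\<close>

definition legendre :: "nat \<Rightarrow> real poly" where
  "legendre n = smult (1 / (2 ^ n * fact n)) ((pderiv ^^ n) ([:-1, 0, 1:] ^ n))"

definition shifted_legendre :: "nat \<Rightarrow> real \<Rightarrow> real" where
  "shifted_legendre n x = sqrt (2 * real n + 1) * poly (legendre n) (2 * x - 1)"

text \<open>The lemmas below justify the normalization: \<open>shifted_legendre n\<close> is a polynomial function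
  of degree \<open>n\<close>, its value at \<open>1\<close> is \<open>sqrt (2 * n + 1)\<close>, and the family is orthonormal on
  \<open>[0,1]\<close>.\<close>

lemma degree_higher_pderiv: "degree ((pderiv ^^ k) (p :: real poly)) = degree p - k"
  by (induction k) (auto simp: degree_pderiv)

lemma degree_legendre: "degree (legendre n) = n"
proof -
  have "degree ([:-1, 0, 1:] ^ n :: real poly) = 2 * n"
    by (simp add: degree_power_eq)
  thus ?thesis by (simp add: legendre_def degree_higher_pderiv)
qed

lemma poly_higher_pderiv_root_power:
  "poly ((pderiv ^^ n) ([:-a, 1:] ^ n * g)) (a :: real) = fact n * poly g a"
proof (induction n arbitrary: g)
  case (Suc n)
  have "pderiv ([:-a, 1:] ^ Suc n * g) =
      [:-a, 1:] ^ n * (smult (real (Suc n)) g + [:-a, 1:] * pderiv g)"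
    unfolding pderiv_mult pderiv_power_Suc by (simp add: pderiv_pCons algebra_simps)
  hence "poly ((pderiv ^^ Suc n) ([:-a, 1:] ^ Suc n * g)) a =
      fact n * poly (smult (real (Suc n)) g + [:-a, 1:] * pderiv g) a"
    by (simp only: funpow_Suc_right o_apply Suc)
  thus ?case by (simp add: algebra_simps)
qed simp

lemma shifted_legendre_1: "shifted_legendre n 1 = sqrt (2 * real n + 1)"
proof -
  have "[:-1, 0, 1:] ^ n = [:-1, 1:] ^ n * ([:1, 1:] ^ n :: real poly)"
    by (simp flip: power_mult_distrib)
  thus ?thesis
    by (simp add: shifted_legendre_def legendre_def poly_higher_pderiv_root_power)
qed

lemma higher_pderiv_pcompose_linear:
  "(pderiv ^^ k) (pcompose p [:a, b:]) = smult (b ^ k) (pcompose ((pderiv ^^ k) p) [:a, b :: real:])"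
  by (induction k) (simp_all add: pderiv_smult pderiv_pcompose pderiv_pCons mult.commute)

lemma pcompose_power_real: "pcompose (p ^ n) q = pcompose p (q :: real poly) ^ n"
  by (induction n) (simp_all add: pcompose_mult one_pCons pcompose_pCons)

lemma shifted_legendre_rodrigues:
  "shifted_legendre n x = sqrt (2 * real n + 1) / fact n *
     poly ((pderiv ^^ n) ([:0, 1:] ^ n * [:-1, 1:] ^ n)) x"
proof -
  let ?w = "[:0, 1:] ^ n * [:-1, 1:] ^ n :: real poly"
  have "pcompose ([:-1, 0, 1:] ^ n) [:-1, 2:] = smult (4 ^ n) ?w"
    by (simp add: pcompose_power_real pcompose_pCons flip: power_mult_distrib smult_power)
  hence "smult (2 ^ n) (pcompose ((pderiv ^^ n) ([:-1, 0, 1:] ^ n)) [:-1, 2:]) =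
      smult (4 ^ n) ((pderiv ^^ n) ?w)"
    by (metis higher_pderiv_pcompose_linear higher_pderiv_smult)
  from arg_cong[OF this, of "\<lambda>p. poly p x"]
  have "2 ^ n * poly ((pderiv ^^ n) ([:-1, 0, 1:] ^ n)) (2 * x - 1) =
      4 ^ n * poly ((pderiv ^^ n) ?w) x"
    by (simp only: poly_smult poly_pcompose) (simp add: algebra_simps)
  also have "(4 :: real) ^ n = 2 ^ n * 2 ^ n"
    by (simp flip: power_mult_distrib)
  finally
  have "poly ((pderiv ^^ n) ([:-1, 0, 1:] ^ n)) (2 * x - 1) = 2 ^ n * poly ((pderiv ^^ n) ?w) x"
    by simp
  thus ?thesis by (simp add: shifted_legendre_def legendre_def)
qed

lemma poly_integral_pderiv:
  "integral {0..1} (poly (pderiv p)) = poly p 1 - poly p (0 :: real)"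
proof -
  have "(poly (pderiv p) has_integral (poly p 1 - poly p 0)) {0..1}"
    by (rule fundamental_theorem_of_calculus)
       (auto simp: has_real_derivative_iff_has_vector_derivative[symmetric]
             intro!: DERIV_subset[OF poly_DERIV])
  thus ?thesis by blast
qed

lemma poly_integrable_01: "poly (p :: real poly) integrable_on {0..1}"
  by (intro integrable_continuous_interval continuous_intros)

lemma poly_integral_linear:
  "integral {0..1} (poly (smult c p + smult d q)) =
     c * integral {0..1} (poly p) + d * integral {0..1} (poly (q :: real poly))"
proof -
  have "integral {0..1} (poly (smult c p + smult d q)) =
      integral {0..1} (\<lambda>x. c * poly p x + d * poly q x)"
    by (rule integral_cong) simp
  also have "\<dots> = integral {0..1} (\<lambda>x. c * poly p x) + integral {0..1} (\<lambda>x. d * poly q x)"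
    by (intro integral_add integrable_continuous_interval continuous_intros)
  finally show ?thesis by simp
qed

lemma poly_integral_by_parts:
  assumes "poly q 0 = 0" "poly q 1 = (0 :: real)"
  shows "integral {0..1} (poly (p * pderiv q)) = - integral {0..1} (poly (pderiv p * q))"
proof -
  have "integral {0..1} (poly (pderiv (p * q))) =
      integral {0..1} (poly (p * pderiv q)) + integral {0..1} (poly (pderiv p * q))"
    by (subst integral_add[symmetric])
       (auto intro!: poly_integrable_01 integral_cong simp: pderiv_mult algebra_simps)
  thus ?thesis using assms by (simp add: poly_integral_pderiv)
qed

lemma root_power_dvd_higher_pderiv:
  assumes "[:-a, 1:] ^ n dvd (p :: real poly)"
  shows "[:-a, 1:] ^ (n - k) dvd (pderiv ^^ k) p"
proof (induction k)
  case (Suc k)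
  show ?case
  proof (cases "n - k")
    case (Suc m)
    with Suc.IH obtain g where g: "(pderiv ^^ k) p = [:-a, 1:] ^ Suc m * g"
      by (auto elim: dvdE)
    have "pderiv ([:-a, 1:] ^ Suc m * g) =
        [:-a, 1:] ^ m * (smult (real (Suc m)) g + [:-a, 1:] * pderiv g)"
      unfolding pderiv_mult pderiv_power_Suc by (simp add: pderiv_pCons algebra_simps)
    moreover have "n - Suc k = m" using Suc by simp
    ultimately show ?thesis using g by simp
  qed simp
qed (use assms in simp)

lemma poly_integral_higher_parts:
  assumes "[:0, 1:] ^ n dvd w" "[:-1, 1:] ^ n dvd (w :: real poly)" "k \<le> n"
  shows "integral {0..1} (poly (p * (pderiv ^^ k) w)) =
    (-1) ^ k * integral {0..1} (poly ((pderiv ^^ k) p * w))"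
  using assms(3)
proof (induction k arbitrary: p)
  case (Suc k)
  let ?q = "(pderiv ^^ k) w"
  from Suc.prems have "n - k > 0" by simp
  have "[:0, 1:] ^ (n - k) dvd ?q" "[:-1, 1:] ^ (n - k) dvd ?q"
    using root_power_dvd_higher_pderiv[of 0 n w k] root_power_dvd_higher_pderiv[of 1 n w k] assms
    by simp_all
  with \<open>n - k > 0\<close> have "[:0, 1:] dvd ?q" "[:-1, 1:] dvd ?q"
    by (meson dvd_power dvd_trans)+
  hence "poly ?q 0 = 0" "poly ?q 1 = 0"
    by (simp_all only: poly_eq_0_iff_dvd minus_zero)
  hence "integral {0..1} (poly (p * (pderiv ^^ Suc k) w)) = - integral {0..1} (poly (pderiv p * ?q))"
    by (simp only: funpow.simps o_apply poly_integral_by_parts)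
  also have "\<dots> = - ((-1) ^ k * integral {0..1} (poly ((pderiv ^^ k) (pderiv p) * w)))"
    using Suc.IH[of "pderiv p"] Suc.prems by linarith
  finally show ?case by (simp only: funpow_Suc_right[of k pderiv] o_apply power_Suc
      mult_minus1 mult_minus_left funpow.simps funpow_swap1)
qed simp

lemma poly_integral_beta:
  "integral {0..1} (poly ([:0, 1:] ^ a * [:-1, 1:] ^ b)) =
     (-1) ^ b * fact a * fact b / (fact (a + b + 1) :: real)"
proof (induction b arbitrary: a)
  case 0
  have "pderiv (smult (1 / real (Suc a)) ([:0, 1:] ^ Suc a)) = [:0, 1:] ^ a"
    unfolding pderiv_smult pderiv_power_Suc by (simp add: pderiv_pCons)
  from poly_integral_pderiv[of "smult (1 / real (Suc a)) ([:0, 1:] ^ Suc a)", unfolded this]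
  have "integral {0..1} (poly ([:0, 1:] ^ a)) = 1 / real (Suc a)" by simp
  also have "\<dots> = (-1) ^ 0 * fact a * fact 0 / fact (a + 0 + 1)" by simp
  finally show ?case by (simp only: power_0 mult_1_right)
next
  case (Suc b)
  have 1: "pderiv ([:0, 1:] ^ Suc a) = smult (real (Suc a)) ([:0, 1:] ^ a)"
    unfolding pderiv_power_Suc by (simp add: pderiv_pCons)
  have 2: "pderiv ([:-1, 1:] ^ Suc b) = smult (real (Suc b)) ([:-1, 1:] ^ b)"
    unfolding pderiv_power_Suc by (simp add: pderiv_pCons)
  have "integral {0..1} (poly (pderiv ([:0, 1:] ^ Suc a * [:-1, 1:] ^ Suc b))) = (0 :: real)"
    by (simp only: poly_integral_pderiv poly_mult poly_power) simp
  also have "pderiv ([:0, 1:] ^ Suc a * [:-1, 1:] ^ Suc b) =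
      smult (real (Suc b)) ([:0, 1:] ^ Suc a * [:-1, 1:] ^ b) +
      smult (real (Suc a)) ([:0, 1:] ^ a * [:-1, 1:] ^ Suc b)"
    unfolding pderiv_mult 1 2 by (simp only: mult_smult_right mult_smult_left mult.commute)
  also have "integral {0..1} (poly \<dots>) =
      real (Suc b) * integral {0..1} (poly ([:0, 1:] ^ Suc a * [:-1, 1:] ^ b)) +
      real (Suc a) * integral {0..1} (poly ([:0, 1:] ^ a * [:-1, 1:] ^ Suc b))"
    by (rule poly_integral_linear)
  finally have "real (Suc a) * integral {0..1} (poly ([:0, 1:] ^ a * [:-1, 1:] ^ Suc b)) =
      - real (Suc b) * ((-1) ^ b * fact (Suc a) * fact b / fact (Suc a + b + 1))"
    unfolding Suc by linarith
  also have "\<dots> = real (Suc a) * ((-1) ^ Suc b * fact a * fact (Suc b) / fact (a + Suc b + 1))"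
    by (simp add: field_simps del: of_nat_Suc)
  finally show ?case using mult_left_cancel[of "real (Suc a)"] of_nat_neq_0 by metis
qed

lemma shifted_legendre_orthogonal:
  assumes "m < n"
  shows "integral {0..1} (\<lambda>x. shifted_legendre m x * shifted_legendre n x) = 0"
proof -
  let ?w = "\<lambda>n. [:0, 1:] ^ n * [:-1, 1:] ^ n :: real poly"
  let ?p = "(pderiv ^^ m) (?w m)"
  have "degree ?p = m"
    by (simp add: degree_higher_pderiv degree_mult_eq degree_power_eq)
  hence "degree ((pderiv ^^ m) ?p) = 0"
    by (simp add: degree_higher_pderiv)
  then obtain c where c: "(pderiv ^^ m) ?p = [:c:]"
    by (meson degree_eq_zeroE)
  from assms obtain j where n: "n = j + Suc m"
    by (metis add.commute less_iff_Suc_add add_Suc_right)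
  have "(pderiv ^^ n) ?p = (pderiv ^^ j) (pderiv ((pderiv ^^ m) ?p))"
    by (simp only: n funpow_add funpow.simps o_apply)
  hence "(pderiv ^^ n) ?p = 0" by (simp only: c) (simp add: pderiv_pCons)
  hence I: "integral {0..1} (poly (?p * (pderiv ^^ n) (?w n))) = 0"
    by (subst poly_integral_higher_parts[of n]) (auto simp: poly_0 integral_0 fun_eq_iff
      intro!: integral_unique has_integral_is_0)
  define c where "c = sqrt (2 * real m + 1) / fact m * (sqrt (2 * real n + 1) / fact n)"
  have "integral {0..1} (\<lambda>x. shifted_legendre m x * shifted_legendre n x) =
      integral {0..1} (\<lambda>x. c * poly (?p * (pderiv ^^ n) (?w n)) x)"
    unfolding shifted_legendre_rodrigues c_def
    by (intro integral_cong) (simp only: poly_mult mult_ac)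
  thus ?thesis unfolding integral_mult_right I by simp
qed

lemma shifted_legendre_norm:
  "integral {0..1} (\<lambda>x. shifted_legendre n x * shifted_legendre n x) = 1"
proof -
  let ?w = "[:0, 1:] ^ n * [:-1, 1:] ^ n :: real poly"
  have deg: "degree ?w = 2 * n"
    by (simp add: degree_mult_eq degree_power_eq)
  have "lead_coeff ?w = 1"
    by (simp add: lead_coeff_mult lead_coeff_power)
  hence lc: "coeff ?w (2 * n) = 1" by (simp only: deg)
  have "(pderiv ^^ n) ((pderiv ^^ n) ?w) = (pderiv ^^ (2 * n)) ?w"
    by (simp add: funpow_add mult_2)
  also have "\<dots> = [:fact (2 * n):]"
  proof (rule poly_eqI)
    fix i show "coeff ((pderiv ^^ (2 * n)) ?w) i = coeff [:fact (2 * n):] i"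
    proof (cases i)
      case 0
      thus ?thesis by (simp add: coeff_higher_pderiv lc pochhammer_fact)
    next
      case (Suc j)
      hence "coeff ?w (i + 2 * n) = 0" by (intro coeff_eq_0) (simp add: deg)
      thus ?thesis using Suc by (simp add: coeff_higher_pderiv)
    qed
  qed
  finally have D: "(pderiv ^^ n) ((pderiv ^^ n) ?w) = [:fact (2 * n):]" .
  have "integral {0..1} (poly ((pderiv ^^ n) ?w * (pderiv ^^ n) ?w)) =
      (-1) ^ n * integral {0..1} (poly ([:fact (2 * n):] * ?w))"
    unfolding D[symmetric] by (rule poly_integral_higher_parts) auto
  also have "integral {0..1} (poly ([:fact (2 * n):] * ?w)) =
      fact (2 * n) * integral {0..1} (poly ?w)"
    by (simp only: integral_mult_right[symmetric])
       (rule integral_cong, simp)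
  also have "(-1) ^ n * \<dots> = (fact n) ^ 2 / (2 * real n + 1)"
  proof -
    have F: "fact (n + n + 1) = (2 * real n + 1) * (fact (2 * n) :: real)"
      unfolding mult_2[symmetric] Suc_eq_plus1[symmetric] fact_Suc by simp
    have sgn: "(-1) ^ n * (-1) ^ n = (1 :: real)"
      by (simp only: power_mult_distrib[symmetric]) simp
    have aux: "s * (c * (s * a * a / f)) = a ^ 2 / d" if "s * s = 1" "f = d * c" "c \<noteq> 0"
      for s c a f d :: real
    proof -
      have "s * (c * (s * a * a / f)) = (s * s) * (c * a * a / f)"
        by (simp only: ac_simps times_divide_eq_right times_divide_eq_left)
      thus ?thesis using that by (simp add: power2_eq_square)
    qed
    show ?thesis
      unfolding poly_integral_beta by (rule aux[OF sgn F]) simp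
  qed
  finally have I: "integral {0..1} (poly ((pderiv ^^ n) ?w * (pderiv ^^ n) ?w)) =
      (fact n) ^ 2 / (2 * real n + 1)" .
  have "integral {0..1} (\<lambda>x. shifted_legendre n x * shifted_legendre n x) =
      integral {0..1} (\<lambda>x. (2 * real n + 1) / (fact n) ^ 2 *
        poly ((pderiv ^^ n) ?w * (pderiv ^^ n) ?w) x)"
    unfolding shifted_legendre_rodrigues
    by (intro integral_cong) (simp add: power2_eq_square)
  also have "\<dots> = (2 * real n + 1) / (fact n) ^ 2 * ((fact n) ^ 2 / (2 * real n + 1))"
    unfolding integral_mult_right I ..
  also have "\<dots> = 1" by simp
  finally show ?thesis .
qed

lemma shifted_legendre_orthonormal:
  "integral {0..1} (\<lambda>x. shifted_legendre n x * shifted_legendre m x) = (if n = m then 1 else 0)"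
proof (cases n m rule: linorder_cases)
  case greater
  thus ?thesis using shifted_legendre_orthogonal[of m n] by (simp add: mult.commute)
qed (simp_all add: shifted_legendre_orthogonal shifted_legendre_norm)

subsection \<open>State space models\<close>

text \<open>The matrix exponential of a square matrix as an entrywise power series; the series converges
  by the lemma below, so \<open>suminf\<close> is not applied to a divergent series.\<close>

definition mat_exp :: "real mat \<Rightarrow> real mat" where
  "mat_exp A = mat (dim_row A) (dim_row A) (\<lambda>(i, j). \<Sum>k. (A ^\<^sub>m k) $$ (i, j) / fact k)"

lemma summable_mat_exp:
  assumes A: "A \<in> carrier_mat N N" and ij: "i < N" "j < N"
  shows "summable (\<lambda>k. (A ^\<^sub>m k) $$ (i, j) / fact k :: real)"
proof -
  define c where "c = (\<Sum>l<N. \<Sum>m<N. \<bar>A $$ (l, m)\<bar>)"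
  have c: "\<bar>A $$ (l, m)\<bar> \<le> c" if "l < N" "m < N" for l m
  proof -
    have "\<bar>A $$ (l, m)\<bar> \<le> (\<Sum>m<N. \<bar>A $$ (l, m)\<bar>)"
      using that by (intro member_le_sum) auto
    also have "\<dots> \<le> c"
      unfolding c_def using that
      by (intro member_le_sum[of l "{..<N}" "\<lambda>l. \<Sum>m<N. \<bar>A $$ (l, m)\<bar>"]) (auto intro: sum_nonneg)
    finally show ?thesis .
  qed
  have bound: "\<bar>(A ^\<^sub>m k) $$ (i, m)\<bar> \<le> (real N * c) ^ k" if "m < N" for k m
    using that
  proof (induction k arbitrary: m)
    case 0
    thus ?case using A ij by simp
  next
    case (Suc k)
    have P: "A ^\<^sub>m k \<in> carrier_mat N N" using A by simp
    have "(A ^\<^sub>m Suc k) $$ (i, m) = (\<Sum>l<N. (A ^\<^sub>m k) $$ (i, l) * A $$ (l, m))"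
      using A P ij Suc.prems by (simp add: scalar_prod_def lessThan_atLeast0)
    also have "\<bar>\<dots>\<bar> \<le> (\<Sum>l<N. \<bar>(A ^\<^sub>m k) $$ (i, l) * A $$ (l, m)\<bar>)"
      by (rule sum_abs)
    also have "\<dots> \<le> (\<Sum>l<N. (real N * c) ^ k * c)"
      unfolding abs_mult using Suc c
      by (intro sum_mono mult_mono) (auto intro: order_trans[OF abs_ge_zero])
    finally show ?case by (simp add: algebra_simps)
  qed
  show ?thesis
  proof (rule summable_comparison_test)
    show "\<exists>K. \<forall>k\<ge>K. norm ((A ^\<^sub>m k) $$ (i, j) / fact k) \<le> (real N * c) ^ k / fact k"
      using bound[OF ij(2)] by (auto intro!: divide_right_mono)
    show "summable (\<lambda>k. (real N * c) ^ k / fact k)"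
      using summable_exp[of "real N * c"] by (simp add: field_simps)
  qed
qed

text \<open>The system \<open>x'(t) = A x(t) + B u(t)\<close> of state dimension \<open>N\<close> is represented by its matrices
  \<open>A\<close> and \<open>B\<close>; components are numbered from \<open>0\<close> to \<open>N - 1\<close>.\<close>

definition basis_kernel :: "nat \<Rightarrow> real mat \<Rightarrow> real vec \<Rightarrow> nat \<Rightarrow> real \<Rightarrow> real" where
  "basis_kernel N A B n t = unit_vec N n \<bullet> (mat_exp (t \<cdot>\<^sub>m A) *\<^sub>v B)"

text \<open>Integrability is stated explicitly because the Lebesgue integral of a non-integrable
  function is \<open>0\<close> in HOL.\<close>

definition tossm ::
  "nat \<Rightarrow> real mat \<Rightarrow> real vec \<Rightarrow> (nat \<Rightarrow> real \<Rightarrow> real) \<Rightarrow> (real \<Rightarrow> real) \<Rightarrow> bool" where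
  "tossm N A B p \<omega> \<longleftrightarrow>
     A \<in> carrier_mat N N \<and> B \<in> carrier_vec N \<and>
     (\<forall>t\<ge>0. \<omega> t \<ge> 0) \<and>
     (\<forall>n<N. \<forall>t\<ge>0. basis_kernel N A B n t = p n t * \<omega> t) \<and>
     (\<forall>n<N. \<forall>m<N.
        set_integrable lborel {0..} (\<lambda>t. p n t * p m t * \<omega> t) \<and>
        (LBINT t:{0..}. p n t * p m t * \<omega> t) = (if n = m then 1 else 0))"

end

(* With x = e^(-t), the contiguous relations of the Legendre polynomials give
   (x L_n)' = - sum_k A_nk L_k. Comparing the coefficients of x^j, the vector c_j of the j-th
   coefficients of L_0, ..., L_(N-1) satisfies A c_j = -(j+1) c_j. Since B is the vector of the
   values L_n(1), it is the sum of the c_j, so e^(tA) B = sum_j e^(-(j+1)t) c_j, whose n-th entry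
   is e^(-t) L_n(e^(-t)). The same substitution turns orthonormality on [0,1] into orthonormality
   with respect to e^(-t) dt. *)

theory Submission
  imports Defs
begin

subsection \<open>Contiguous relations of the Legendre polynomials\<close>

text \<open>Leibniz rule: the second derivative of the factor z vanishes, so only two terms
  survive.\<close>

lemma higher_pderiv_X_mult:
  "(pderiv ^^ Suc k) ([:0, 1:] * p) =
     [:0, 1:] * (pderiv ^^ Suc k) p + smult (real (Suc k)) ((pderiv ^^ k) p)"
proof (induction k)
  case 0
  show ?case by (simp add: pderiv_mult pderiv_pCons)
next
  case (Suc k)
  have "(pderiv ^^ Suc (Suc k)) ([:0, 1:] * p) = pderiv ((pderiv ^^ Suc k) ([:0, 1:] * p))"
    by simp
  also have "\<dots> = [:0, 1:] * (pderiv ^^ Suc (Suc k)) p + (pderiv ^^ Suc k) p +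
      smult (real (Suc k)) ((pderiv ^^ Suc k) p)"
    unfolding Suc by (simp add: pderiv_add pderiv_mult pderiv_smult pderiv_pCons)
  also have "\<dots> = [:0, 1:] * (pderiv ^^ Suc (Suc k)) p +
      smult (real (Suc (Suc k))) ((pderiv ^^ Suc k) p)"
    by (simp only: of_nat_Suc[of "Suc k"] smult_add_left smult_1_left add.assoc)
  finally show ?case .
qed

lemma higher_pderiv_diff:
  fixes p q :: "'a :: idom poly"
  shows "(pderiv ^^ k) (p - q) = (pderiv ^^ k) p - (pderiv ^^ k) q"
  by (induction k) (simp_all add: pderiv_diff)

lemma pderiv_rodrigues_power:
  "pderiv ([:-1, 0, 1:] ^ Suc n) = smult (2 * real (Suc n)) ([:0, 1:] * [:-1, 0, 1:] ^ n)"
proof -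
  have "pderiv [:-1, 0, 1 :: real:] = smult 2 [:0, 1:]"
    by (simp add: pderiv_pCons)
  thus ?thesis
    unfolding pderiv_power_Suc by (simp add: mult.commute del: of_nat_Suc)
qed

lemma higher_pderiv_rodrigues_Suc:
  "(pderiv ^^ Suc k) ([:-1, 0, 1:] ^ Suc n) =
     smult (2 * real (Suc n)) ((pderiv ^^ k) ([:0, 1:] * [:-1, 0, 1:] ^ n))"
  unfolding funpow_Suc_right o_apply pderiv_rodrigues_power by (rule higher_pderiv_smult)

text \<open>In Rodrigues' formula, spend one of the n + 2 derivatives on the power (z^2 - 1)^(n+1).
  Its factor 2(n+1) adjusts the normalization to that of degree n, and the other n + 1 derivatives
  act on z (z^2 - 1)^n by the Leibniz rule.\<close>

lemma pderiv_legendre_Suc: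
  "pderiv (legendre (Suc n)) = [:0, 1:] * pderiv (legendre n) + smult (real (Suc n)) (legendre n)"
proof -
  let ?w = "[:-1, 0, 1:] ^ n :: real poly"
  have "pderiv (legendre (Suc n)) = smult (1 / (2 ^ Suc n * fact (Suc n)))
      ((pderiv ^^ Suc (Suc n)) ([:-1, 0, 1:] ^ Suc n))"
    by (simp add: legendre_def pderiv_smult del: power_Suc)
  also have "\<dots> = smult (1 / (2 ^ n * fact n)) ((pderiv ^^ Suc n) ([:0, 1:] * ?w))"
    unfolding higher_pderiv_rodrigues_Suc by (simp add: field_simps del: funpow.simps of_nat_Suc)
  also have "\<dots> = [:0, 1:] * pderiv (legendre n) + smult (real (Suc n)) (legendre n)"
    unfolding higher_pderiv_X_mult
    by (simp add: legendre_def pderiv_smult smult_add_right mult.commute)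
  finally show ?thesis .
qed

text \<open>Computing the derivative of order \<open>n + 1\<close> of \<open>(z\<^sup>2 - 1) ^ (n + 1)\<close> once by differentiating the
  power and once by the product rule for \<open>z * (z * w) - w\<close>, \<open>w = (z\<^sup>2 - 1) ^ n\<close>.\<close>

lemma legendre_Suc_eq:
  "smult (real (Suc n)) (legendre (Suc n)) =
     [:-1, 0, 1:] * pderiv (legendre n) + smult (real (Suc n)) ([:0, 1:] * legendre n)"
proof -
  let ?w = "[:-1, 0, 1:] ^ n :: real poly"
  let ?D = "\<lambda>p :: real poly. (pderiv ^^ n) p" and ?E = "\<lambda>p :: real poly. (pderiv ^^ Suc n) p"
  let ?Q = "?E ([:-1, 0, 1:] ^ Suc n)"
  \<comment> \<open>One derivative of the power brings out 2(n+1). So the lower-order term of the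
    product rule is half of \<open>?Q\<close> itself, and cancelling it leaves an equation for the
    other half.\<close>
  have 1: "smult (real (Suc n)) (?D ([:0, 1:] * ?w)) = smult (1 / 2) ?Q"
    unfolding higher_pderiv_rodrigues_Suc by (simp del: of_nat_Suc)
  have "[:-1, 0, 1:] ^ Suc n = [:0, 1:] * ([:0, 1:] * ?w) - ?w"
    by (simp add: algebra_simps)
  hence "?Q = ?E ([:0, 1:] * ([:0, 1:] * ?w)) - ?E ?w"
    by (simp only: higher_pderiv_diff)
  also have "\<dots> = [:0, 1:] * ([:0, 1:] * ?E ?w + smult (real (Suc n)) (?D ?w)) +
      smult (1 / 2) ?Q - ?E ?w"
    by (simp only: higher_pderiv_X_mult[of n "[:0, 1:] * ?w"] higher_pderiv_X_mult[of n ?w] 1)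
  also have "\<dots> = [:-1, 0, 1:] * ?E ?w + smult (real (Suc n)) ([:0, 1:] * ?D ?w) + smult (1 / 2) ?Q"
    by (simp add: algebra_simps del: of_nat_Suc)
  finally have "?Q = [:-1, 0, 1:] * ?E ?w + smult (real (Suc n)) ([:0, 1:] * ?D ?w) +
      smult (1 / 2) ?Q" .
  moreover have "?Q = smult (1 / 2) ?Q + smult (1 / 2) ?Q"
    by (simp only: smult_add_left[symmetric]) simp
  ultimately have 2: "smult (1 / 2) ?Q =
      [:-1, 0, 1:] * ?E ?w + smult (real (Suc n)) ([:0, 1:] * ?D ?w)"
    by (metis add_right_cancel)
  have "smult (real (Suc n)) (legendre (Suc n)) = smult (1 / (2 ^ n * fact n)) (smult (1 / 2) ?Q)"
    unfolding legendre_def by (simp add: field_simps del: funpow.simps of_nat_Suc)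
  also have "\<dots> = [:-1, 0, 1:] * pderiv (legendre n) + smult (real (Suc n)) ([:0, 1:] * legendre n)"
    unfolding 2 legendre_def by (simp add: pderiv_smult smult_add_right mult.commute)
  finally show ?thesis .
qed

text \<open>Writing P_n for \<open>legendre n\<close>, the two relations combine to (1+z) P_(n+1)' =
  (n+1) P_(n+1) + (1+z) P_n' + (n+1) P_n. In the induction, n P_n from the hypothesis and (n+1) P_n
  make up the new summand (2n+1) P_n.\<close>

lemma pderiv_legendre_sum:
  "[:1, 1:] * pderiv (legendre n) =
     smult (real n) (legendre n) + (\<Sum>k<n. smult (2 * real k + 1) (legendre k))"
proof (induction n)
  case 0
  show ?case by (simp add: legendre_def pderiv_pCons one_pCons)
next
  case (Suc n)
  let ?P = "legendre n" and ?P' = "pderiv (legendre n)"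
  \<comment> \<open>Both relations, the first one multiplied by z, contain (n+1) z P_n; eliminating
    it leaves z^2 P_n' - (z^2 - 1) P_n' = P_n'.\<close>
  have X: "[:0, 1:] * pderiv (legendre (Suc n)) = smult (real (Suc n)) (legendre (Suc n)) + ?P'"
    unfolding pderiv_legendre_Suc legendre_Suc_eq by (simp add: algebra_simps del: of_nat_Suc)
  have "[:1, 1:] * pderiv (legendre (Suc n)) =
      [:0, 1:] * pderiv (legendre (Suc n)) + pderiv (legendre (Suc n))"
    by simp
  also have "\<dots> = smult (real (Suc n)) (legendre (Suc n)) + ([:1, 1:] * ?P' + smult (real (Suc n)) ?P)"
    unfolding X unfolding pderiv_legendre_Suc by simp
  also have "\<dots> = smult (real (Suc n)) (legendre (Suc n)) +
      (\<Sum>k<Suc n. smult (2 * real k + 1) (legendre k))"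
    unfolding Suc by (intro poly_ext) (simp add: poly_sum algebra_simps)
  finally show ?case .
qed

text \<open>A polynomial object is needed besides the function \<open>shifted_legendre\<close>,
  since its coefficients form the eigenvectors below.\<close>

definition shifted_legendre_poly :: "nat \<Rightarrow> real poly" where
  "shifted_legendre_poly n = smult (sqrt (2 * real n + 1)) (pcompose (legendre n) [:-1, 2:])"

lemma poly_shifted_legendre_poly: "poly (shifted_legendre_poly n) = shifted_legendre n"
  by (simp add: fun_eq_iff shifted_legendre_poly_def shifted_legendre_def poly_pcompose algebra_simps)

lemma degree_shifted_legendre_poly: "degree (shifted_legendre_poly n) = n"
  by (simp add: shifted_legendre_poly_def degree_legendre degree_pcompose add_nonneg_eq_0_iff)

text \<open>At z = 2x - 1 the factor 1 + z is 2x, which is x times the inner derivative of the chain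
  rule. The product rule adds one more copy of the polynomial itself, turning n into n + 1.\<close>

lemma pderiv_X_mult_shifted_legendre_poly:
  "pderiv ([:0, 1:] * shifted_legendre_poly n) =
     smult (real (Suc n)) (shifted_legendre_poly n) +
     (\<Sum>k<n. smult (sqrt (2 * real n + 1) * sqrt (2 * real k + 1)) (shifted_legendre_poly k))"
proof (rule poly_ext)
  fix x
  have "2 * x * poly (pderiv (legendre n)) (2 * x - 1) =
      real n * poly (legendre n) (2 * x - 1) +
      (\<Sum>k<n. (2 * real k + 1) * poly (legendre k) (2 * x - 1))"
    using arg_cong[OF pderiv_legendre_sum[of n], of "\<lambda>p. poly p (2 * x - 1)"]
    by (simp add: poly_sum algebra_simps)
  \<comment> \<open>Split 2k+1 into two square roots: one normalizes the k-th polynomial, the other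
    stays as part of the matrix entry.\<close>
  hence "sqrt (2 * real n + 1) * (2 * x * poly (pderiv (legendre n)) (2 * x - 1)) =
      sqrt (2 * real n + 1) * (real n * poly (legendre n) (2 * x - 1) +
      (\<Sum>k<n. sqrt (2 * real k + 1) * (sqrt (2 * real k + 1) * poly (legendre k) (2 * x - 1))))"
    by (simp add: mult.assoc[symmetric])
  thus "poly (pderiv ([:0, 1:] * shifted_legendre_poly n)) x =
    poly (smult (real (Suc n)) (shifted_legendre_poly n) +
     (\<Sum>k<n. smult (sqrt (2 * real n + 1) * sqrt (2 * real k + 1)) (shifted_legendre_poly k))) x"
    by (simp add: shifted_legendre_poly_def pderiv_mult pderiv_smult pderiv_pcompose pderiv_pCons
        poly_pcompose poly_sum sum_distrib_left algebra_simps)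
qed

subsection \<open>The matrix exponential on an eigenvector\<close>

lemma pow_mat_mult_eigenvector:
  fixes A :: "'a :: field mat"
  assumes A: "A \<in> carrier_mat N N" and v: "v \<in> carrier_vec N" and "A *\<^sub>v v = c \<cdot>\<^sub>v v"
  shows "A ^\<^sub>m k *\<^sub>v v = c ^ k \<cdot>\<^sub>v v"
proof (induction k)
  case 0
  show ?case using A v by simp
next
  case (Suc k)
  have P: "A ^\<^sub>m k \<in> carrier_mat N N" using A by simp
  have "A ^\<^sub>m Suc k *\<^sub>v v = A ^\<^sub>m k *\<^sub>v (A *\<^sub>v v)"
    using assoc_mult_mat_vec[OF P A v] by simp
  also have "\<dots> = c \<cdot>\<^sub>v (A ^\<^sub>m k *\<^sub>v v)"
    unfolding assms(3) by (rule mult_mat_vec[OF P v])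
  finally show ?case unfolding Suc by (simp add: smult_smult_assoc)
qed

lemma mat_exp_carrier: "A \<in> carrier_mat N N \<Longrightarrow> mat_exp A \<in> carrier_mat N N"
  by (simp add: mat_exp_def)

text \<open>On an eigenvector the k-th power acts as c^k, so the entrywise series collapses to the
  scalar exponential series. Summability of each entry permits exchanging the series with the finite
  sum over a row.\<close>

lemma mat_exp_mult_eigenvector:
  assumes A: "A \<in> carrier_mat N N" and v: "v \<in> carrier_vec N" and "A *\<^sub>v v = c \<cdot>\<^sub>v v"
  shows "mat_exp A *\<^sub>v v = exp c \<cdot>\<^sub>v v"
proof (rule eq_vecI)
  fix i assume "i < dim_vec (exp c \<cdot>\<^sub>v v)"
  hence i: "i < N" using v by simp
  let ?P = "\<lambda>k j. (A ^\<^sub>m k) $$ (i, j)"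
  have P: "(\<Sum>j<N. ?P k j * v $ j) = c ^ k * v $ i" for k
  proof -
    have "(\<Sum>j<N. ?P k j * v $ j) = (A ^\<^sub>m k *\<^sub>v v) $ i"
      using A v i by (simp add: scalar_prod_def lessThan_atLeast0)
    thus ?thesis using pow_mat_mult_eigenvector[OF assms, of k] v i by simp
  qed
  have "(mat_exp A *\<^sub>v v) $ i = (\<Sum>j<N. (\<Sum>k. ?P k j / fact k) * v $ j)"
    using A v i by (simp add: mat_exp_def scalar_prod_def lessThan_atLeast0)
  also have "\<dots> = (\<Sum>j<N. \<Sum>k. ?P k j / fact k * v $ j)"
    using summable_mat_exp[OF A i] by (intro sum.cong suminf_mult2) auto
  also have "\<dots> = (\<Sum>k. \<Sum>j<N. ?P k j / fact k * v $ j)"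
    using summable_mat_exp[OF A i] by (intro suminf_sum[symmetric] summable_mult2) auto
  also have "\<dots> = (\<Sum>k. c ^ k / fact k * v $ i)"
    using P by (simp flip: sum_divide_distrib)
  also have "\<dots> = exp c * v $ i"
    using suminf_mult2[OF summable_exp_generic[of c], of "v $ i"]
    by (simp add: exp_def divide_inverse mult.commute)
  finally show "(mat_exp A *\<^sub>v v) $ i = (exp c \<cdot>\<^sub>v v) $ i" using v i by simp
qed (use A v in \<open>auto simp: mat_exp_def\<close>)

subsection \<open>Polynomials in the exponential\<close>

text \<open>The integrand is nonnegative, so evaluating its nonnegative integral by the
  antiderivative - exp(-ct)/c gives integrability together with the value.\<close>

lemma has_bochner_integral_exp_Ici:
  assumes "c > 0"
  shows "has_bochner_integral lborel (\<lambda>t. indicator {0..} t *\<^sub>R exp (- (c * t))) (1 / c :: real)"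
proof (rule has_bochner_integral_nn_integral)
  have "((\<lambda>t. - exp (- (c * t)) / c) \<longlongrightarrow> - 0 / c) at_top"
    using assms by (intro tendsto_intros filterlim_compose[OF exp_at_bot]
        filterlim_compose[OF filterlim_uminus_at_bot_at_top]
        filterlim_tendsto_pos_mult_at_top[OF tendsto_const] filterlim_ident) auto
  hence "(\<integral>\<^sup>+ t. ennreal (exp (- (c * t))) * indicator {0..} t \<partial>lborel) =
      ennreal (0 - (- exp (- (c * 0)) / c))"
    using assms by (intro nn_integral_FTC_atLeast) (auto intro!: derivative_eq_intros)
  thus "(\<integral>\<^sup>+ t. ennreal (indicator {0..} t *\<^sub>R exp (- (c * t))) \<partial>lborel) = ennreal (1 / c)"
    by (simp add: indicator_mult_ennreal mult.commute)
qed (use assms in auto)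

lemma integral_poly_01:
  fixes p :: "real poly"
  shows "integral {0..1} (poly p) = (\<Sum>j\<le>degree p. coeff p j / real (Suc j))"
proof -
  have *: "((\<lambda>x. coeff p j * x ^ j) has_integral coeff p j * (1 / real (Suc j))) {0..1}" for j
  proof (rule has_integral_mult_right)
    have "((\<lambda>x. x ^ j) has_integral 1 ^ Suc j / real (Suc j) - 0 ^ Suc j / real (Suc j)) {0..1}"
      by (rule fundamental_theorem_of_calculus)
         (auto simp: has_real_derivative_iff_has_vector_derivative[symmetric]
               simp del: power_Suc of_nat_Suc intro!: derivative_eq_intros)
    thus "((\<lambda>x. x ^ j) has_integral 1 / real (Suc j)) {0..1}" by simp
  qed
  have "((\<lambda>x. \<Sum>j\<le>degree p. coeff p j * x ^ j) has_integral
      (\<Sum>j\<le>degree p. coeff p j * (1 / real (Suc j)))) {0..1}"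
    by (intro has_integral_sum * finite_atMost)
  thus ?thesis by (simp add: poly_altdef[abs_def] integral_unique)
qed

lemma exp_minus_power_times:
  fixes t :: real
  shows "exp (- t) ^ j * exp (- t) = exp (- (real (Suc j) * t))"
  using exp_of_nat_mult[of "Suc j" "- t"] by (simp add: mult.commute)

lemma poly_exp_times_exp:
  fixes t :: real
  shows "poly p (exp (- t)) * exp (- t) = (\<Sum>j\<le>degree p. coeff p j * exp (- (real (Suc j) * t)))"
  by (simp only: poly_altdef sum_distrib_right mult.assoc exp_minus_power_times)

text \<open>The substitution x = exp(-t), done monomial by monomial: x^j on [0,1] and exp(-(j+1)t)
  on the half-line both have integral 1/(j+1).\<close>

lemma has_bochner_integral_poly_exp:
  fixes p :: "real poly"
  shows "has_bochner_integral lborel (\<lambda>t. indicator {0..} t *\<^sub>R (poly p (exp (- t)) * exp (- t)))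
     (integral {0..1} (poly p))"
proof -
  have "has_bochner_integral lborel
      (\<lambda>t. \<Sum>j\<le>degree p. coeff p j * (indicator {0..} t *\<^sub>R exp (- (real (Suc j) * t))))
      (\<Sum>j\<le>degree p. coeff p j * (1 / real (Suc j)))"
    by (intro has_bochner_integral_sum has_bochner_integral_mult_right has_bochner_integral_exp_Ici)
       simp
  thus ?thesis
    by (simp add: poly_exp_times_exp integral_poly_01 sum_distrib_left mult.left_commute
        del: of_nat_Suc)
qed

text \<open>A product of two basis polynomials is again a polynomial, so orthonormality on [0,1]
  carries over. The indicator form is what the set integrals in \<open>tossm\<close> unfold
  to.\<close>

lemma shifted_legendre_exp_orthonormal:
  "has_bochner_integral lborel
     (\<lambda>t. indicator {0..} t *\<^sub>R (shifted_legendre n (exp (- t)) * shifted_legendre m (exp (- t)) * exp (- t)))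
     (if n = m then 1 else 0)"
  using has_bochner_integral_poly_exp[of "shifted_legendre_poly n * shifted_legendre_poly m"]
  unfolding poly_mult[abs_def] poly_shifted_legendre_poly shifted_legendre_orthonormal .

subsection \<open>The basis kernels\<close>

text \<open>Row n of the product is minus the x^j coefficient of (x L_n)', and p -> (x p)'
  multiplies x^j by j + 1. For j >= N the vector \<open>c j\<close> is zero and the equation is
  trivial.\<close>

lemma shifted_legendre_coeffs_eigenvector:
  assumes A: "A \<in> carrier_mat N N"
    and entries: "\<And>n k. n < N \<Longrightarrow> k < N \<Longrightarrow>
      A $$ (n, k) = - sqrt (2 * real n + 1) * sqrt (2 * real k + 1) *
        (if n > k then 1
         else if n = k then (real n + 1) / (2 * real n + 1)
         else 0)"
  defines "c \<equiv> \<lambda>j. vec N (\<lambda>n. coeff (shifted_legendre_poly n) j)"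
  shows "A *\<^sub>v c j = - real (Suc j) \<cdot>\<^sub>v c j"
proof (rule eq_vecI)
  fix n assume "n < dim_vec (- real (Suc j) \<cdot>\<^sub>v c j)"
  hence n: "n < N" by (simp add: c_def)
  let ?l = "\<lambda>k. coeff (shifted_legendre_poly k) j"
  let ?s = "\<lambda>k. sqrt (2 * real k + 1)"
  have "(A *\<^sub>v c j) $ n = (\<Sum>k<N. A $$ (n, k) * ?l k)"
    using A n by (simp add: c_def scalar_prod_def lessThan_atLeast0)
  also have "\<dots> = (\<Sum>k<Suc n. A $$ (n, k) * ?l k)"
    using n entries by (intro sum.mono_neutral_right) auto
  also have "\<dots> = A $$ (n, n) * ?l n + (\<Sum>k<n. A $$ (n, k) * ?l k)"
    by simp
  also have "A $$ (n, n) = - real (Suc n)"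
  proof -
    have "2 * real n + 1 \<noteq> 0" by (simp add: add_nonneg_eq_0_iff)
    hence "- (2 * real n + 1) * ((real n + 1) / (2 * real n + 1)) = - real (Suc n)"
      by (simp only: minus_mult_left[symmetric]) simp
    thus ?thesis using n entries[of n n] by simp
  qed
  also have "(\<Sum>k<n. A $$ (n, k) * ?l k) = - (\<Sum>k<n. ?s n * ?s k * ?l k)"
    using n entries by (simp flip: sum_negf)
  also have "- real (Suc n) * ?l n + - (\<Sum>k<n. ?s n * ?s k * ?l k) =
      - coeff (pderiv ([:0, 1:] * shifted_legendre_poly n)) j"
    unfolding pderiv_X_mult_shifted_legendre_poly by (simp add: coeff_sum del: of_nat_Suc)
  \<comment> \<open>Differentiation lowers the index by one and the factor x raises it by one, so
    the coefficient index remains j.\<close>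
  also have "\<dots> = - real (Suc j) * ?l n"
    by (simp add: coeff_pderiv del: of_nat_Suc)
  finally show "(A *\<^sub>v c j) $ n = (- real (Suc j) \<cdot>\<^sub>v c j) $ n"
    using n by (simp add: c_def)
qed (use A in \<open>simp_all add: c_def\<close>)

lemma basis_kernel_shifted_legendre:
  assumes A: "A \<in> carrier_mat N N" and B: "B \<in> carrier_vec N"
    and entries: "\<And>n k. n < N \<Longrightarrow> k < N \<Longrightarrow>
      A $$ (n, k) = - sqrt (2 * real n + 1) * sqrt (2 * real k + 1) *
        (if n > k then 1
         else if n = k then (real n + 1) / (2 * real n + 1)
         else 0)"
    and B_entries: "\<And>n. n < N \<Longrightarrow> B $ n = sqrt (2 * real n + 1)"
    and n: "n < N"
  shows "basis_kernel N A B n t = shifted_legendre n (exp (- t)) * exp (- t)"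
proof -
  define c where "c = (\<lambda>j. vec N (\<lambda>n. coeff (shifted_legendre_poly n) j))"
  let ?l = shifted_legendre_poly
  have c: "c j \<in> carrier_vec N" for j by (simp add: c_def)
  define E where "E = mat_exp (t \<cdot>\<^sub>m A)"
  have tA: "t \<cdot>\<^sub>m A \<in> carrier_mat N N" using A by simp
  have E: "E \<in> carrier_mat N N" unfolding E_def using tA by (rule mat_exp_carrier)
  have "(t \<cdot>\<^sub>m A) *\<^sub>v c j = - (real (Suc j) * t) \<cdot>\<^sub>v c j" for j
  proof -
    have "(t \<cdot>\<^sub>m A) *\<^sub>v c j = t \<cdot>\<^sub>v (A *\<^sub>v c j)"
      using A c[of j] by (intro eq_vecI) (auto simp: scalar_prod_def sum_distrib_left mult.assoc)
    also have "A *\<^sub>v c j = - real (Suc j) \<cdot>\<^sub>v c j"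
      unfolding c_def by (rule shifted_legendre_coeffs_eigenvector[OF A entries])
    finally show ?thesis
      by (simp add: smult_smult_assoc mult.commute del: of_nat_Suc)
  qed
  hence Ev: "E *\<^sub>v c j = exp (- (real (Suc j) * t)) \<cdot>\<^sub>v c j" for j
    unfolding E_def by (intro mat_exp_mult_eigenvector[OF tA c])
  hence Ec: "(\<Sum>m<N. E $$ (n, m) * coeff (?l m) j) = exp (- (real (Suc j) * t)) * coeff (?l n) j" for j
  proof -
    have "(\<Sum>m<N. E $$ (n, m) * coeff (?l m) j) = (E *\<^sub>v c j) $ n"
      using n E by (simp add: c_def scalar_prod_def lessThan_atLeast0)
    thus ?thesis unfolding Ev using n by (simp add: c_def)
  qed
  \<comment> \<open>Padding with zero coefficients gives all polynomials the same range j < N, so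
    that the sums over m and j can be swapped.\<close>
  have sum_coeff: "poly (?l m) x = (\<Sum>j<N. coeff (?l m) j * x ^ j)" if "m < N" for m x
    unfolding poly_altdef degree_shifted_legendre_poly using that
    by (intro sum.mono_neutral_left) (auto simp: coeff_eq_0 degree_shifted_legendre_poly)
  have "basis_kernel N A B n t = (\<Sum>m<N. E $$ (n, m) * B $ m)"
    unfolding basis_kernel_def E_def[symmetric] using E B n
    by (simp add: scalar_prod_left_unit[of _ N] scalar_prod_def[of "row E n"] lessThan_atLeast0)
  \<comment> \<open>The entries of \<open>B\<close> are the values at 1, that is, the sums of the
    coefficients; this writes \<open>B\<close> as the sum of the eigenvectors
    \<open>c j\<close>.\<close>
  also have "\<dots> = (\<Sum>m<N. E $$ (n, m) * poly (?l m) 1)"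
    using B_entries by (simp add: poly_shifted_legendre_poly shifted_legendre_1)
  also have "\<dots> = (\<Sum>m<N. \<Sum>j<N. E $$ (n, m) * coeff (?l m) j)"
    by (simp add: sum_coeff sum_distrib_left)
  also have "\<dots> = (\<Sum>j<N. exp (- (real (Suc j) * t)) * coeff (?l n) j)"
    unfolding Ec[symmetric] by (rule sum.swap)
  \<comment> \<open>Of the j + 1 factors exp(-t), j form the power of the argument and the last one
    is the measure.\<close>
  also have "\<dots> = poly (?l n) (exp (- t)) * exp (- t)"
    unfolding sum_coeff[OF n] sum_distrib_right
    by (intro sum.cong) (simp_all only: mult.assoc exp_minus_power_times mult.commute[of "exp (- (_ * t))"])
  finally show ?thesis unfolding poly_shifted_legendre_poly .
qed

theorem corollary3p3:
  fixes N :: nat and A :: "real mat" and B :: "real vec"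
  assumes "N \<ge> 1"
    and "A \<in> carrier_mat N N" and "B \<in> carrier_vec N"
    and "\<And>n k. n < N \<Longrightarrow> k < N \<Longrightarrow>
      A $$ (n, k) = - sqrt (2 * real n + 1) * sqrt (2 * real k + 1) *
        (if n > k then 1
         else if n = k then (real n + 1) / (2 * real n + 1)
         else 0)"
    and "\<And>n. n < N \<Longrightarrow> B $ n = sqrt (2 * real n + 1)"
  shows "tossm N A B (\<lambda>n t. shifted_legendre n (exp (- t))) (\<lambda>t. exp (- t))"
  unfolding tossm_def set_integrable_def set_lebesgue_integral_def
  using assms(2,3) basis_kernel_shifted_legendre[OF assms(2-5)] shifted_legendre_exp_orthonormal
  by (auto simp: has_bochner_integral_iff)

end
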